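(* There exists a monotonically shrinking temporal cycle $\mathcal{C}$ (that is, a monotonically shrinking temporal graph whose underlying static graph is a cycle) such that there is no Nash equilibrium in the two-player reverse temporal Voronoi game $\mathrm{rVor}(\mathcal{C},2)$.
   Context: A temporal graph $\mathcal{G}=(V,(E_t)_{t=1}^\infty)$ consists of a finite nonempty vertex set $V$ and an infinite sequence of edge sets $E_t\subseteq\binom{V}{2}$; it is assumed that the sequence is eventually constant (finite lifetime), i.e. there is $\tau$ with $E_t=E_\tau$ for all $t\ge\tau$. The underlying static graph is $(V,\bigcup_{t\ge1}E_t)$. A temporal cycle is a temporal graph whose underlying graph is a cycle. $\mathcal{G}$ is monotonically shrinking if $E_{t+1}\subseteq E_t$ for all $t\ge 1$. A temporal walk from $u$ to $v$ is a sequence $(\{v_0=u,v_1\},t_1),(\{v_1,v_2\},t_2),\dots,(\{v_{d-1},v_d=v\},t_d)$ with $t_i<t_{i+1}$ for all $i\in\{1,\dots,d-1\}$ (strictly increasing times) and $\{v_{i-1},v_i\}\in E_{t_i}$ for all $i\in\{1,\dots,d\}$; its arrival time is $t_d$. The temporal distance $\mathrm{td}(u,v)$ is the minimum arrival time of a temporal walk from $u$ to $v$, with $\mathrm{td}(u,u)=0$ and $\mathrm{td}(u,v)=\infty$ if there is no such walk. In the two-player reverse temporal Voronoi game $\mathrm{rVor}(\mathcal{G},2)$, each player $i\in\{1,2\}$ selects one vertex $p_i\in V$ (equal choices are allowed). Player $i$ wins the set $U_i(p_1,p_2)=\{v\in V\mid \mathrm{td}(v,p_i)<\mathrm{td}(v,p_j)\}$,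 where $j\ne i$ is the other player, and her payoff is $u_i(p_1,p_2)=|U_i(p_1,p_2)|$. A profile $(p_1,p_2)\in V^2$ is a Nash equilibrium if $u_1(p',p_2)\le u_1(p_1,p_2)$ and $u_2(p_1,p')\le u_2(p_1,p_2)$ for all $p'\in V$. *)

theory Defs
  imports Complex_Main "HOL-Library.Extended_Nat"
begin

(* The edge set at time t is E t for t >= 1; the value E 0 is never used. *)

definition temporal_graph :: "'a set \<Rightarrow> (nat \<Rightarrow> 'a set set) \<Rightarrow> bool" where
  "temporal_graph V E \<longleftrightarrow>
     finite V \<and> V \<noteq> {} \<and>
     (\<forall>t\<ge>1. E t \<subseteq> {e. e \<subseteq> V \<and> card e = 2}) \<and>
     (\<exists>\<tau>\<ge>1. \<forall>t\<ge>\<tau>. E t = E \<tau>)"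

definition underlying_edges :: "(nat \<Rightarrow> 'a set set) \<Rightarrow> 'a set set" where
  "underlying_edges E = (\<Union>t\<in>{1..}. E t)"

definition is_cycle_graph :: "'a set \<Rightarrow> 'a set set \<Rightarrow> bool" where
  "is_cycle_graph V F \<longleftrightarrow>
     (\<exists>(n::nat) c. n \<ge> 3 \<and> bij_betw c {..<n} V \<and> F = {{c i, c ((i + 1) mod n)} | i. i < n})"

definition temporal_cycle :: "'a set \<Rightarrow> (nat \<Rightarrow> 'a set set) \<Rightarrow> bool" where
  "temporal_cycle V E \<longleftrightarrow> temporal_graph V E \<and> is_cycle_graph V (underlying_edges E)"

definition monotonically_shrinking :: "(nat \<Rightarrow> 'a set set) \<Rightarrow> bool" where
  "monotonically_shrinking E \<longleftrightarrow> (\<forall>t\<ge>1. E (t + 1) \<subseteq> E t)"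

(* vs = [v_0, ..., v_d] and ts = [t_1, ..., t_d] with d >= 1, so that the i-th
   edge {v_(i-1), v_i} is {vs ! (i-1), vs ! i} and is used at time ts ! (i-1). *)
definition temporal_walk ::
  "(nat \<Rightarrow> 'a set set) \<Rightarrow> 'a \<Rightarrow> 'a \<Rightarrow> 'a list \<Rightarrow> nat list \<Rightarrow> bool" where
  "temporal_walk E u v vs ts \<longleftrightarrow>
     ts \<noteq> [] \<and> length vs = length ts + 1 \<and> hd vs = u \<and> last vs = v \<and>
     sorted_wrt (<) ts \<and>
     (\<forall>i<length ts. ts ! i \<ge> 1 \<and> {vs ! i, vs ! (i + 1)} \<in> E (ts ! i))"

(* The infimum is a minimum when a walk exists, and Inf {} = \<infinity> in enat. *)
definition td :: "(nat \<Rightarrow> 'a set set) \<Rightarrow> 'a \<Rightarrow> 'a \<Rightarrow> enat" where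
  "td E u v =
     (if u = v then 0 else Inf {enat (last ts) | vs ts. temporal_walk E u v vs ts})"

(* p is the player's own choice, q that of her opponent; distances are measured
   from the vertex x to the players' positions. *)
definition rvor_won :: "'a set \<Rightarrow> (nat \<Rightarrow> 'a set set) \<Rightarrow> 'a \<Rightarrow> 'a \<Rightarrow> 'a set" where
  "rvor_won V E p q = {x \<in> V. td E x p < td E x q}"

definition rvor_payoff :: "'a set \<Rightarrow> (nat \<Rightarrow> 'a set set) \<Rightarrow> 'a \<Rightarrow> 'a \<Rightarrow> nat" where
  "rvor_payoff V E p q = card (rvor_won V E p q)"

(* By symmetry of the rules, u_1(p1,p2) = rvor_payoff V E p1 p2 and
   u_2(p1,p2) = rvor_payoff V E p2 p1. *)
definition rvor_nash_equilibrium :: "'a set \<Rightarrow> (nat \<Rightarrow> 'a set set) \<Rightarrow> 'a \<Rightarrow> 'a \<Rightarrow> bool" where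
  "rvor_nash_equilibrium V E p1 p2 \<longleftrightarrow>
     p1 \<in> V \<and> p2 \<in> V \<and>
     (\<forall>p'\<in>V. rvor_payoff V E p' p2 \<le> rvor_payoff V E p1 p2) \<and>
     (\<forall>p'\<in>V. rvor_payoff V E p' p1 \<le> rvor_payoff V E p2 p1)"

end

theory Submission
  imports Defs
begin

text \<open>In the 9-cycle with all edges present at time 1, every third edge at time 2 and no edge later,
  a vertex is reached from itself, its two neighbours and, if it lies on a surviving edge, from one
  further vertex. Every vertex has a reply that wins 4 vertices, the largest number from which any
  vertex can be reached, so in an equilibrium both players would win 4 vertices, on disjoint sets.
  But any two such 4-element sets intersect.\<close>

definition cycle9_edges :: "nat set set" where
  "cycle9_edges = {{i, (i + 1) mod 9} | i. i < 9}"

text \<open>At time 2 the vertices 1, 4 and 7 are isolated. Each of them lies between two surviving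
  edges on the cycle, and these are the vertices where basins overlap.\<close>

definition surviving_edges :: "nat set set" where
  "surviving_edges = {{2, 3}, {5, 6}, {8, 0}}"

definition shrinking_cycle9 :: "nat \<Rightarrow> nat set set" where
  "shrinking_cycle9 t = (if t \<le> 1 then cycle9_edges else if t = 2 then surviving_edges else {})"

lemma cycle9_edges_eq:
  "cycle9_edges = {{0, 1}, {1, 2}, {2, 3}, {3, 4}, {4, 5}, {5, 6}, {6, 7}, {7, 8}, {8, 0}}"
proof -
  have "cycle9_edges = (\<lambda>i. {i, (i + 1) mod 9}) ` {..<9}"
    by (auto simp: cycle9_edges_def)
  also have "{..<9::nat} = {0, 1, 2, 3, 4, 5, 6, 7, 8}"
    by auto
  finally show ?thesis
    by (simp add: numeral_2_eq_2)
qed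

lemma surviving_subset_cycle9: "surviving_edges \<subseteq> cycle9_edges"
  by (simp add: surviving_edges_def cycle9_edges_eq)

lemma temporal_cycle_shrinking_cycle9: "temporal_cycle {..<9} shrinking_cycle9"
proof -
  have subs: "cycle9_edges \<subseteq> {e. e \<subseteq> {..<9} \<and> card e = 2}"
    by (simp add: cycle9_edges_eq)
  have "temporal_graph {..<9} shrinking_cycle9"
    unfolding temporal_graph_def
  proof (intro conjI)
    show "\<forall>t\<ge>1. shrinking_cycle9 t \<subseteq> {e. e \<subseteq> {..<9} \<and> card e = 2}"
      using subs surviving_subset_cycle9 by (auto simp: shrinking_cycle9_def)
    show "\<exists>\<tau>\<ge>1. \<forall>t\<ge>\<tau>. shrinking_cycle9 t = shrinking_cycle9 \<tau>"
      \<comment> \<open>From time 3 on the edge set is constantly empty.\<close>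
      by (rule exI[of _ 3]) (simp add: shrinking_cycle9_def)
  qed (auto simp: lessThan_empty_iff)
  moreover have "underlying_edges shrinking_cycle9 = cycle9_edges"
  proof
    show "underlying_edges shrinking_cycle9 \<subseteq> cycle9_edges"
      using surviving_subset_cycle9 by (auto simp: underlying_edges_def shrinking_cycle9_def)
    have "shrinking_cycle9 1 \<subseteq> underlying_edges shrinking_cycle9"
      unfolding underlying_edges_def by (intro UN_upper) simp
    then show "cycle9_edges \<subseteq> underlying_edges shrinking_cycle9"
      by (simp add: shrinking_cycle9_def)
  qed
  moreover have "is_cycle_graph {..<9} cycle9_edges"
    unfolding is_cycle_graph_def cycle9_edges_def
    by (rule exI[of _ 9], rule exI[of _ "\<lambda>i. i"]) (simp add: bij_betw_def)
  ultimately show ?thesis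
    by (simp add: temporal_cycle_def)
qed

lemma monotonically_shrinking_cycle9: "monotonically_shrinking shrinking_cycle9"
  using surviving_subset_cycle9
  by (auto simp: monotonically_shrinking_def shrinking_cycle9_def)

lemma strict_sorted_list_of_1_2:
  fixes ts :: "nat list"
  assumes "sorted_wrt (<) ts" "set ts \<subseteq> {1, 2}" "ts \<noteq> []"
  shows "ts = [1] \<or> ts = [2] \<or> ts = [1, 2]"
proof (cases ts)
  case (Cons a as)
  show ?thesis
  proof (cases as)
    case (Cons b bs)
    with assms \<open>ts = a # as\<close> show ?thesis by (cases bs) auto
  qed (use assms \<open>ts = a # as\<close> in auto)
qed (use assms in simp)

text \<open>No edges exist after time 2 and times strictly increase, so a walk has one edge, or two
  edges used at times 1 and 2. A single edge used at time 2 also lies in \<open>E 1\<close> because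
  \<open>E 2 \<subseteq> E 1\<close>.\<close>

lemma temporal_walk_two_times_cases:
  assumes "\<And>t. t > 2 \<Longrightarrow> E t = {}" and "E 2 \<subseteq> E 1" and walk: "temporal_walk E u v vs ts"
  shows "{u, v} \<in> E 1 \<and> last ts \<in> {1, 2} \<or> (\<exists>w. {u, w} \<in> E 1 \<and> {w, v} \<in> E 2) \<and> last ts = 2"
proof -
  have "set ts \<subseteq> {1, 2}"
  proof
    fix t assume "t \<in> set ts"
    then obtain i where i: "i < length ts" "ts ! i = t"
      by (auto simp: in_set_conv_nth)
    with walk have "t \<ge> 1" "E t \<noteq> {}"
      by (auto simp: temporal_walk_def)
    with assms(1)[of t] have "\<not> t > 2" by blast
    with \<open>t \<ge> 1\<close> show "t \<in> {1, 2}" by auto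
  qed
  then consider "ts = [1]" | "ts = [2]" | "ts = [1, 2]"
    using walk strict_sorted_list_of_1_2[of ts] by (auto simp: temporal_walk_def)
  then show ?thesis
  proof cases
    case 3
    with walk obtain w where "vs = [u, w, v]"
      by (auto simp: temporal_walk_def length_Suc_conv)
    with walk 3 show ?thesis
      by (auto simp: temporal_walk_def All_less_Suc)
  qed (use walk assms(2) in \<open>auto simp: temporal_walk_def length_Suc_conv\<close>)
qed

text \<open>This replaces the infimum over walks by adjacency tests. A one-edge walk at time 2 can
  be advanced to time 1, so distance 2 arises only from two-edge walks between vertices not joined
  in \<open>E 1\<close>.\<close>

lemma td_two_times:
  assumes "\<And>t. t > 2 \<Longrightarrow> E t = {}" and "E 2 \<subseteq> E 1"
  shows "td E u v = (if u = v then 0 else if {u, v} \<in> E 1 then 1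
           else if \<exists>w. {u, w} \<in> E 1 \<and> {w, v} \<in> E 2 then 2 else \<infinity>)"
proof -
  let ?A = "{enat (last ts) | vs ts. temporal_walk E u v vs ts}"
  note cases = temporal_walk_two_times_cases[OF assms]
  have "Inf ?A = 1" if e: "{u, v} \<in> E 1"
  proof (rule antisym)
    have "temporal_walk E u v [u, v] [1]"
      using e by (simp add: temporal_walk_def)
    then have "enat (last [1]) \<in> ?A" by blast
    then show "Inf ?A \<le> 1" by (simp add: Inf_lower one_enat_def)
    show "1 \<le> Inf ?A"
      by (rule Inf_greatest) (use cases in \<open>fastforce simp: one_enat_def\<close>)
  qed
  moreover have "Inf ?A = 2" if e: "{u, v} \<notin> E 1" "{u, w} \<in> E 1" "{w, v} \<in> E 2" for w
  proof (rule antisym)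
    have "temporal_walk E u v [u, w, v] [1, 2]"
      using e by (simp add: temporal_walk_def All_less_Suc)
    then have "enat (last [1, 2]) \<in> ?A" by blast
    then show "Inf ?A \<le> 2" by (simp add: Inf_lower numeral_eq_enat)
    show "2 \<le> Inf ?A"
      by (rule Inf_greatest) (use e(1) cases in \<open>fastforce simp: numeral_eq_enat\<close>)
  qed
  moreover have "Inf ?A = \<infinity>"
    if "{u, v} \<notin> E 1" "\<nexists>w. {u, w} \<in> E 1 \<and> {w, v} \<in> E 2"
  proof -
    have "?A = {}" using that cases by blast
    then show ?thesis by (simp add: Inf_enat_def)
  qed
  ultimately show ?thesis
    by (auto simp: td_def)
qed

text \<open>The six pairs of distance 2 start at 1, 4 or 7: the walk steps onto the near end of an
  adjacent surviving edge at time 1 and crosses it at time 2, as in 1, 2, 3.\<close>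

lemma td_shrinking_cycle9:
  "td shrinking_cycle9 x p = (if x = p then 0 else if {x, p} \<in> cycle9_edges then 1
     else if (x, p) \<in> {(1, 3), (4, 2), (4, 6), (7, 5), (7, 0), (1, 8)} then 2 else \<infinity>)"
proof -
  \<comment> \<open>The last step enters \<open>p\<close> along a surviving edge, which gives six
    cases: three edges in two directions.\<close>
  have two_step: "(\<exists>w. {x, w} \<in> cycle9_edges \<and> {w, p} \<in> surviving_edges) \<longleftrightarrow>
      p = 2 \<and> {x, 3} \<in> cycle9_edges \<or> p = 3 \<and> {x, 2} \<in> cycle9_edges \<or>
      p = 5 \<and> {x, 6} \<in> cycle9_edges \<or> p = 6 \<and> {x, 5} \<in> cycle9_edges \<or>
      p = 8 \<and> {x, 0} \<in> cycle9_edges \<or> p = 0 \<and> {x, 8} \<in> cycle9_edges"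
    by (auto simp: surviving_edges_def doubleton_eq_iff)
  have nbrs: "{x, 0} \<in> cycle9_edges \<longleftrightarrow> x = 8 \<or> x = 1" "{x, 2} \<in> cycle9_edges \<longleftrightarrow> x = 1 \<or> x = 3"
    "{x, 3} \<in> cycle9_edges \<longleftrightarrow> x = 2 \<or> x = 4" "{x, 5} \<in> cycle9_edges \<longleftrightarrow> x = 4 \<or> x = 6"
    "{x, 6} \<in> cycle9_edges \<longleftrightarrow> x = 5 \<or> x = 7" "{x, 8} \<in> cycle9_edges \<longleftrightarrow> x = 7 \<or> x = 0"
    by (auto simp: cycle9_edges_eq doubleton_eq_iff)
  \<comment> \<open>The condition \<open>x \<noteq> p\<close> rules out going back and forth along a
    surviving edge.\<close>
  have "(\<exists>w. {x, w} \<in> cycle9_edges \<and> {w, p} \<in> surviving_edges) \<longleftrightarrow>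
      (x, p) \<in> {(1, 3), (4, 2), (4, 6), (7, 5), (7, 0), (1, 8)}" if "x \<noteq> p"
    unfolding two_step nbrs using that by auto
  moreover have "td shrinking_cycle9 x p = (if x = p then 0 else if {x, p} \<in> cycle9_edges then 1
      else if \<exists>w. {x, w} \<in> cycle9_edges \<and> {w, p} \<in> surviving_edges then 2 else \<infinity>)"
    using surviving_subset_cycle9
    by (subst td_two_times) (simp_all add: shrinking_cycle9_def)
  ultimately show ?thesis
    by (simp only: if_False split: if_split) blast
qed

text \<open>For \<open>p < 9\<close> these are the vertices that can reach \<open>p\<close>. The
  last branch then means \<open>p\<close> is 8 or 0, so the basins of size 4 belong to the ends of
  surviving edges.\<close>

definition basin9 :: "nat \<Rightarrow> nat set" where
  "basin9 p = (if p = 1 then {0, 1, 2} else if p = 4 then {3, 4, 5} else if p = 7 then {6, 7, 8}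
     else if p \<in> {2, 3} then {1, 2, 3, 4} else if p \<in> {5, 6} then {4, 5, 6, 7}
     else {7, 8, 0, 1})"

lemma less_9_cases: "p < 9 \<Longrightarrow> p \<in> {0, 1, 2, 3, 4, 5, 6, 7, 8 :: nat}"
  by auto

lemma finite_td_in_basin9:
  assumes "p < 9" "td shrinking_cycle9 x p < \<infinity>"
  shows "x \<in> basin9 p"
proof -
  have "x = p \<or> {x, p} \<in> cycle9_edges \<or> (x, p) \<in> {(1, 3), (4, 2), (4, 6), (7, 5), (7, 0), (1, 8)}"
    using assms(2) by (auto simp: td_shrinking_cycle9 split: if_splits)
  then show ?thesis
    using less_9_cases[OF assms(1)]
    by (elim insertE emptyE) (auto simp: cycle9_edges_eq basin9_def doubleton_eq_iff)
qed

text \<open>Winning a vertex requires a strictly smaller distance, hence a finite one.\<close>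

lemma rvor_won_subset_basin9:
  assumes "p < 9"
  shows "rvor_won {..<9} shrinking_cycle9 p q \<subseteq> basin9 p"
proof
  fix x assume "x \<in> rvor_won {..<9} shrinking_cycle9 p q"
  then have "td shrinking_cycle9 x p < td shrinking_cycle9 x q"
    by (simp add: rvor_won_def)
  also have "\<dots> \<le> \<infinity>" by simp
  finally show "x \<in> basin9 p"
    using assms by (rule finite_td_in_basin9[rotated])
qed

lemma card_basin9: "card (basin9 p) \<le> 4"
  by (simp add: basin9_def)

text \<open>There are only three basins of size 4, and any two distinct ones share exactly one of
  the vertices 1, 4 and 7.\<close>

lemma big_basins9_meet:
  assumes "4 \<le> card (basin9 p)" "4 \<le> card (basin9 q)"
  shows "basin9 p \<inter> basin9 q \<noteq> {}"
  using assms unfolding basin9_def by (auto split: if_splits)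

lemma exists_reply_winning_4:
  assumes "q < 9"
  shows "\<exists>r<9. 4 \<le> rvor_payoff {..<9} shrinking_cycle9 r q"
proof -
  have "\<exists>r<9. basin9 r \<subseteq> rvor_won {..<9} shrinking_cycle9 r q \<and> card (basin9 r) = 4"
  proof -
    \<comment> \<open>The basin of \<open>r\<close> has size 4 and is either disjoint from that of
      \<open>q\<close> or meets it in one vertex, which has distance 1 to \<open>r\<close> but 2 to
      \<open>q\<close>. So \<open>r\<close> wins its whole basin.\<close>
    define r :: nat where
      "r = (if q \<in> {1, 2} then 5 else if q = 0 then 6 else if q \<in> {3, 4} then 0
            else if q = 5 then 8 else if q = 6 then 3 else 2)"
    show ?thesis
      using less_9_cases[OF assms]
      by (intro exI[of _ r], elim insertE emptyE)
        (simp_all add: r_def basin9_def rvor_won_def td_shrinking_cycle9 cycle9_edges_eq doubleton_eq_iff)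
  qed
  moreover have "finite (rvor_won {..<9} shrinking_cycle9 r q)" for r
    by (simp add: rvor_won_def)
  ultimately show ?thesis
    unfolding rvor_payoff_def by (metis card_mono)
qed

theorem theorem7:
  shows "\<exists>(V :: nat set) (E :: nat \<Rightarrow> nat set set).
           temporal_cycle V E \<and> monotonically_shrinking E \<and>
           \<not> (\<exists>p1 p2. rvor_nash_equilibrium V E p1 p2)"
proof (intro exI conjI)
  show "\<not> (\<exists>p1 p2. rvor_nash_equilibrium {..<9} shrinking_cycle9 p1 p2)"
  proof
    assume "\<exists>p1 p2. rvor_nash_equilibrium {..<9} shrinking_cycle9 p1 p2"
    then obtain p q where pq: "p < 9" "q < 9"
      and best: "\<forall>r<9. rvor_payoff {..<9} shrinking_cycle9 r q \<le> rvor_payoff {..<9} shrinking_cycle9 p q"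
        "\<forall>r<9. rvor_payoff {..<9} shrinking_cycle9 r p \<le> rvor_payoff {..<9} shrinking_cycle9 q p"
      by (auto simp: rvor_nash_equilibrium_def)
    let ?U = "rvor_won {..<9} shrinking_cycle9"
    \<comment> \<open>Each equilibrium payoff is at least that of the reply winning 4
      vertices.\<close>
    have big: "4 \<le> card (?U p q)" "4 \<le> card (?U q p)"
      using best exists_reply_winning_4 pq unfolding rvor_payoff_def by (meson order_trans)+
    \<comment> \<open>A set of at least 4 vertices inside a basin of at most 4 fills the
      basin.\<close>
    have won_eq: "?U p' q' = basin9 p'" if "p' < 9" "4 \<le> card (?U p' q')" for p' q'
      using that card_basin9[of p'] by (intro card_seteq rvor_won_subset_basin9) (auto simp: basin9_def)
    have "?U p q = basin9 p" "?U q p = basin9 q"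
      using won_eq pq big by blast+
    moreover have "?U p q \<inter> ?U q p = {}"
      by (auto simp: rvor_won_def)
    ultimately show False
      using big_basins9_meet[of p q] big by simp
  qed
qed (fact temporal_cycle_shrinking_cycle9 monotonically_shrinking_cycle9)+

end
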